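(* Let $\alpha\in(0,2)$ and let $\mu$ be a symmetric probability law on $\mathbb{R}$ that is regularly varying with index $\alpha$. Let $p=p_n$ be a sequence of positive integers such that $p_n\to\infty$ and $p_n/n^2\to 0$ as $n\to\infty$. For each $n$ let $\boldsymbol{X}_1,\dots,\boldsymbol{X}_n$ be i.i.d. random vectors drawn from the symmetric $\alpha$-spherical distribution $\mu_{\alpha,p_n}$ on $\mathbb{S}^{p_n-1}$ associated with $\mu$. Then, as $n\to\infty$, $$R_n=\frac{\sqrt{2p_n}}{n}\sum_{1\le i<j\le n}\boldsymbol{X}_i^{\top}\boldsymbol{X}_j$$ converges in distribution to the standard normal distribution $N(0,1)$.
   Context: $\mathbb{S}^{p-1}=\{x\in\mathbb{R}^p:\|x\|_2=1\}$. A probability law $\mu$ on $\mathbb{R}$ is regularly varying with index $\alpha\in(0,2)$ if, for $X\sim\mu$, $\mathbb{P}(|X|\ge x)\sim L(x)x^{-\alpha}$ as $x\to\infty$ for some slowly varying function $L$, i.e. $\lim_{x\to\infty}L(ax)/L(x)=1$ for all $a>0$. The $\alpha$-spherical distribution $\mu_{\alpha,p}$ associated with such a $\mu$ is the distribution on $\mathbb{S}^{p-1}$ of the random vector $$\left(\frac{X_1}{\sqrt{\sum_{k=1}^pX_k^2}},\dots,\frac{X_p}{\sqrt{\sum_{k=1}^pX_k^2}}\right),$$ where $X_1,\dots,X_p$ are i.i.d. with law $\mu$ (it being understood that this is a distribution supported on $\mathbb{S}^{p-1}$, i.e. the denominator is almost surely nonzero). If $\mu$ is symmetric ($X$ and $-X$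 have the same law), $\mu_{\alpha,p}$ is called a symmetric $\alpha$-spherical distribution. *)

theory Defs
  imports "HOL-Probability.Probability" "HOL-Library.Landau_Symbols"
begin

definition slowly_varying :: "(real \<Rightarrow> real) \<Rightarrow> bool" where
  "slowly_varying L \<longleftrightarrow> (\<forall>a>0. ((\<lambda>x. L (a * x) / L x) \<longlongrightarrow> 1) at_top)"

definition regularly_varying_law :: "real \<Rightarrow> real measure \<Rightarrow> bool" where
  "regularly_varying_law \<alpha> \<mu> \<longleftrightarrow>
     (\<exists>L. slowly_varying L \<and>
          (\<lambda>x. measure \<mu> {y. \<bar>y\<bar> \<ge> x}) \<sim>[at_top] (\<lambda>x. L x * x powr (- \<alpha>)))"

definition symmetric_law :: "real measure \<Rightarrow> bool" where
  "symmetric_law \<mu> \<longleftrightarrow> distr \<mu> borel uminus = \<mu>"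

text \<open>
  Since the dimension varies along a sequence, vectors in the \<open>p\<close>-dimensional Euclidean space are
  represented as extensional functions on \<open>{..<p}\<close>, i.e. as points of the following product space.
\<close>

abbreviation borel_vec :: "nat \<Rightarrow> (nat \<Rightarrow> real) measure" where
  "borel_vec p \<equiv> Pi\<^sub>M {..<p} (\<lambda>_. borel)"

definition vec_inner :: "nat \<Rightarrow> (nat \<Rightarrow> real) \<Rightarrow> (nat \<Rightarrow> real) \<Rightarrow> real" where
  "vec_inner p x y = (\<Sum>k<p. x k * y k)"

definition self_normalize :: "nat \<Rightarrow> (nat \<Rightarrow> real) \<Rightarrow> (nat \<Rightarrow> real)" where
  "self_normalize p x = (\<lambda>k\<in>{..<p}. x k / sqrt (\<Sum>j<p. (x j)\<^sup>2))"

text \<open>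
  The measure below is concentrated on the unit sphere exactly when the normalizing denominator is
  almost surely nonzero, which is the content of \<open>spherical_well_defined\<close>. The index \<open>\<alpha>\<close> enters
  only through the requirement that \<open>\<mu>\<close> be regularly varying.
\<close>

definition spherical_distribution :: "real measure \<Rightarrow> nat \<Rightarrow> (nat \<Rightarrow> real) measure" where
  "spherical_distribution \<mu> p = distr (Pi\<^sub>M {..<p} (\<lambda>_. \<mu>)) (borel_vec p) (self_normalize p)"

definition spherical_well_defined :: "real measure \<Rightarrow> nat \<Rightarrow> bool" where
  "spherical_well_defined \<mu> p \<longleftrightarrow>
     (AE x in Pi\<^sub>M {..<p} (\<lambda>_. \<mu>). sqrt (\<Sum>j<p. (x j)\<^sup>2) \<noteq> 0)"

lemma self_normalize_measurable:
  assumes "sets \<mu> = sets borel"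
  shows "self_normalize p \<in> Pi\<^sub>M {..<p} (\<lambda>_. \<mu>) \<rightarrow>\<^sub>M borel_vec p"
proof -
  have "self_normalize p \<in> borel_vec p \<rightarrow>\<^sub>M borel_vec p"
    unfolding self_normalize_def by measurable
  moreover have "sets (Pi\<^sub>M {..<p} (\<lambda>_. \<mu>)) = sets (borel_vec p)"
    by (intro sets_PiM_cong refl assms)
  ultimately show ?thesis
    by (simp cong: measurable_cong_sets)
qed

lemma spherical_distribution_on_sphere:
  assumes "sets \<mu> = sets borel" and "spherical_well_defined \<mu> p"
  shows "AE y in spherical_distribution \<mu> p. (\<Sum>k<p. (y k)\<^sup>2) = 1"
proof -
  have *: "(\<Sum>k<p. (self_normalize p x k)\<^sup>2) = 1" if "sqrt (\<Sum>j<p. (x j)\<^sup>2) \<noteq> 0" for x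
  proof -
    have "(\<Sum>k<p. (self_normalize p x k)\<^sup>2) = (\<Sum>k<p. (x k)\<^sup>2 / (\<Sum>j<p. (x j)\<^sup>2))"
      by (intro sum.cong) (auto simp: self_normalize_def power_divide sum_nonneg)
    also have "\<dots> = 1"
      using that by (simp flip: sum_divide_distrib)
    finally show ?thesis .
  qed
  have "Measurable.pred (borel_vec p) (\<lambda>y. (\<Sum>k<p. (y k)\<^sup>2) = 1)"
    by measurable
  hence m: "{y \<in> space (borel_vec p). (\<Sum>k<p. (y k)\<^sup>2) = 1} \<in> sets (borel_vec p)"
    by (simp add: pred_def)
  show ?thesis
    unfolding spherical_distribution_def
    using assms(2) *
    by (subst AE_distr_iff[OF self_normalize_measurable[OF assms(1)] m])
       (auto simp: spherical_well_defined_def elim!: eventually_mono)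
qed

end

theory Submission
  imports Defs
begin

text \<open>
  Write \<open>S\<^sub>m\<close> for the sum of the first \<open>m\<close> vectors and \<open>T\<^sub>m\<close> for the sum of the inner products over
  the pairs \<open>i < j \<le> m\<close>. Adding a vector gives \<open>T\<^sub>m\<^sub>+\<^sub>1 = T\<^sub>m + S\<^sub>m \<bullet> X\<^sub>m\<^sub>+\<^sub>1\<close>, and since the
  vectors are centered and independent, \<open>T\<close> is a martingale. The proof is a martingale central limit theorem carried out by hand on characteristic functions.

  The properties of a single vector on which this rests are collected in the locale
  \<open>isotropic_sphere_law\<close>: the vector has unit length, its coordinates are uncorrelated with second
  moment \<open>1/p\<close>, and it has the same law as its negative. Self-normalization of i.i.d. symmetric
  variables has these properties because it commutes with changing signs and permuting coordinates
  (\<open>isotropic_sphere_law_spherical\<close>).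

  Three facts then carry the argument. Given the past, the increment \<open>S\<^sub>m \<bullet> X\<^sub>m\<^sub>+\<^sub>1\<close> is symmetric with
  variance \<open>|S\<^sub>m|\<^sup>2 / p\<close>. Because the vectors have unit length, \<open>|S\<^sub>m|\<^sup>2 = m + 2 T\<^sub>m\<close>, and \<open>T\<^sub>m\<close> has
  standard deviation at most \<open>m / \<surd>p\<close>; hence the conditional variance is \<open>m / p\<close> up to a relative error
  of order \<open>1 / \<surd>p\<close>. Finally, an inner product of unit vectors is at most 1 in absolute value, so
  its fourth moment is at most its second moment \<open>1/p\<close>, and this gives \<open>m/p + 3 (m/p)\<^sup>2\<close> as
  a bound for the fourth moment of the increment.

  Consequently, passing from \<open>m\<close> to \<open>m + 1\<close> multiplies the characteristic function of \<open>T\<close> at \<open>\<theta>\<close> by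
  \<open>exp (- \<theta>\<^sup>2 m / (2 p))\<close>, with an explicit error (\<open>norm_pair_sum_char_step_le\<close>). The factors have
  modulus at most 1, so the errors merely add up. For \<open>\<theta> = t \<surd>(2 p) / n\<close> the product of the
  factors tends to \<open>exp (- t\<^sup>2 / 2)\<close> and the total error is of order \<open>1/n + 1/\<surd>p + p/n\<^sup>2\<close>
  (\<open>norm_scaled_pair_sum_char_minus_gaussian_le\<close>). The term \<open>p/n\<^sup>2\<close> comes from the fourth moments, and
  is the reason for the growth condition on \<open>p\<close>. Levy's continuity theorem concludes.
\<close>

section \<open>Elementary estimates\<close>

lemma abs_cos_minus_quadratic_le:
  fixes x :: real
  shows "\<bar>cos x - (1 - x\<^sup>2 / 2)\<bar> \<le> x ^ 4 / 24"
proof -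
  obtain t :: real where t: "cos x = (\<Sum>m<4. cos_coeff m * x ^ m) + (cos (t + 1/2 * real 4 * pi) / fact 4) * x ^ 4"
    using Maclaurin_cos_expansion[of x 4] by auto
  have "cos_coeff 0 = 1" "cos_coeff 1 = 0" "cos_coeff 2 = - 1 / 2" "cos_coeff 3 = 0"
    by (simp_all add: cos_coeff_def)
  moreover have "{..<4::nat} = {0, 1, 2, 3}" by auto
  ultimately have "cos x - (1 - x\<^sup>2 / 2) = cos (t + 2 * pi) * (x ^ 4 / 24)"
    using t by (simp add: fact_numeral)
  hence "\<bar>cos x - (1 - x\<^sup>2 / 2)\<bar> = \<bar>cos (t + 2 * pi)\<bar> * (x ^ 4 / 24)"
    by (simp only: abs_mult) simp
  also have "\<dots> \<le> 1 * (x ^ 4 / 24)"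
    by (intro mult_right_mono) auto
  finally show ?thesis by simp
qed

lemma abs_exp_uminus_minus_linear_le:
  fixes b :: real
  assumes "0 \<le> b"
  shows "\<bar>1 - b - exp (- b)\<bar> \<le> b\<^sup>2"
proof -
  have "exp (- b) * (1 + b) \<le> exp (- b) * exp b"
    by (intro mult_left_mono) auto
  hence "exp (- b) * (1 + b) \<le> 1" by (simp flip: exp_add)
  also have "1 \<le> (1 - b + b\<^sup>2) * (1 + b)"
    using assms by (simp add: algebra_simps power2_eq_square)
  finally have "exp (- b) \<le> 1 - b + b\<^sup>2"
    using assms by simp
  moreover have "1 - b \<le> exp (- b)" using exp_ge_add_one_self[of "-b"] by simp
  ultimately show ?thesis by simp
qed

section \<open>Inner products of coordinate vectors\<close>

lemma coordinate_measurable: "k < p \<Longrightarrow> (\<lambda>y. y k) \<in> borel_measurable (borel_vec p)"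
  by (rule measurable_component_singleton) simp

lemma vec_inner_measurable:
  assumes [measurable]: "f \<in> N \<rightarrow>\<^sub>M borel_vec p" "g \<in> N \<rightarrow>\<^sub>M borel_vec p"
  shows "(\<lambda>\<omega>. vec_inner p (f \<omega>) (g \<omega>)) \<in> borel_measurable N"
  unfolding vec_inner_def by measurable

lemma vec_inner_commute: "vec_inner p x y = vec_inner p y x"
  by (simp add: vec_inner_def mult.commute)

lemma vec_inner_sum_left: "vec_inner p (\<lambda>k. \<Sum>i\<in>I. x i k) y = (\<Sum>i\<in>I. vec_inner p (x i) y)"
  unfolding vec_inner_def sum_distrib_right by (rule sum.swap)

lemma vec_inner_square_le: "(vec_inner p x y)\<^sup>2 \<le> vec_inner p x x * vec_inner p y y"
  using Cauchy_Schwarz_ineq_sum[of x y "{..<p}"] by (simp add: vec_inner_def power2_eq_square)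

abbreviation vec_uminus :: "nat \<Rightarrow> (nat \<Rightarrow> real) \<Rightarrow> (nat \<Rightarrow> real)" where
  "vec_uminus p y \<equiv> (\<lambda>k\<in>{..<p}. - y k)"

lemma vec_inner_uminus_right: "vec_inner p x (vec_uminus p y) = - vec_inner p x y"
  by (simp add: vec_inner_def sum_negf)

section \<open>Isotropic symmetric laws on the sphere\<close>

locale isotropic_sphere_law = prob_space \<nu>
  for \<nu> :: "(nat \<Rightarrow> real) measure" +
  fixes p :: nat
  assumes sets_eq [measurable_cong]: "sets \<nu> = sets (borel_vec p)"
    and unit_AE: "AE y in \<nu>. vec_inner p y y = 1"
    and second_moment:
      "\<And>k l. k < p \<Longrightarrow> l < p \<Longrightarrow> (\<integral>y. y k * y l \<partial>\<nu>) = (if k = l then 1 / p else 0)"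
    and uminus_invariant: "distr \<nu> (borel_vec p) (vec_uminus p) = \<nu>"
begin

lemma uminus_measurable: "vec_uminus p \<in> \<nu> \<rightarrow>\<^sub>M borel_vec p"
  by measurable

text \<open>
  For a non-integrable function the Bochner integral is 0 by convention, in agreement with the claim.
\<close>

lemma integral_odd_eq_0:
  fixes f :: "(nat \<Rightarrow> real) \<Rightarrow> real"
  assumes [measurable]: "f \<in> borel_measurable \<nu>" and odd: "\<And>y. f (vec_uminus p y) = - f y"
  shows "(\<integral>y. f y \<partial>\<nu>) = 0"
proof -
  have "(\<integral>y. f y \<partial>\<nu>) = (\<integral>y. f y \<partial>distr \<nu> (borel_vec p) (vec_uminus p))"
    by (simp add: uminus_invariant)
  also have "\<dots> = (\<integral>y. f (vec_uminus p y) \<partial>\<nu>)"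
    by (rule integral_distr[OF uminus_measurable]) (use assms in measurable)
  finally show ?thesis by (simp add: odd)
qed

lemma integrable_bounded_on_sphere:
  fixes f :: "(nat \<Rightarrow> real) \<Rightarrow> 'b::{banach, second_countable_topology}"
  assumes "f \<in> borel_measurable \<nu>" and "\<And>y. vec_inner p y y = 1 \<Longrightarrow> norm (f y) \<le> B"
  shows "integrable \<nu> f"
  using unit_AE by (intro integrable_const_bound[of _ B] assms) (auto elim!: eventually_mono dest: assms(2))

lemma abs_vec_inner_le:
  assumes "vec_inner p y y = 1"
  shows "\<bar>vec_inner p u y\<bar> \<le> sqrt (vec_inner p u u)"
  using vec_inner_square_le[of p u y] assms by (simp add: real_le_rsqrt flip: real_sqrt_abs)

lemma abs_vec_inner_power_le:
  assumes "vec_inner p y y = 1"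
  shows "\<bar>vec_inner p u y ^ q\<bar> \<le> sqrt (vec_inner p u u) ^ q"
  unfolding power_abs using abs_vec_inner_le[OF assms] by (intro power_mono) auto

lemma inner_measurable [measurable]: "(\<lambda>y. vec_inner p u y) \<in> borel_measurable \<nu>"
  unfolding vec_inner_def by measurable

lemma integrable_inner_power: "integrable \<nu> (\<lambda>y. vec_inner p u y ^ q)"
  by (rule integrable_bounded_on_sphere[of _ "sqrt (vec_inner p u u) ^ q"])
     (measurable, simp add: abs_vec_inner_power_le)

lemma integral_inner: "(\<integral>y. vec_inner p u y \<partial>\<nu>) = 0"
  by (rule integral_odd_eq_0) (measurable, simp add: vec_inner_uminus_right)

lemma integral_inner_cube: "(\<integral>y. vec_inner p u y ^ 3 \<partial>\<nu>) = 0"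
  by (rule integral_odd_eq_0) (measurable, simp add: vec_inner_uminus_right)

lemma coordinate_le_1:
  assumes "vec_inner p y y = 1" "k < p"
  shows "\<bar>y k\<bar> \<le> 1"
proof -
  have "y k * y k \<le> vec_inner p y y"
    unfolding vec_inner_def using assms by (intro member_le_sum) auto
  thus ?thesis using assms by (simp add: abs_square_le_1 flip: power2_eq_square)
qed

lemma integral_inner_square: "(\<integral>y. (vec_inner p u y)\<^sup>2 \<partial>\<nu>) = vec_inner p u u / p"
proof -
  have [measurable]: "(\<lambda>y. y k) \<in> borel_measurable \<nu>" if "k < p" for k
    using coordinate_measurable[OF that] by (simp cong: measurable_cong_sets add: sets_eq)
  have int: "integrable \<nu> (\<lambda>y. (u k * u l) * (y k * y l))" if "k < p" "l < p" for k l
  proof (rule integrable_mult_right, rule integrable_bounded_on_sphere[of _ 1])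
    show "(\<lambda>y. y k * y l) \<in> borel_measurable \<nu>" using that by measurable
    fix y assume "vec_inner p y y = 1"
    thus "norm (y k * y l) \<le> 1"
      using coordinate_le_1[of y k] coordinate_le_1[of y l] that by (simp add: abs_mult mult_le_one)
  qed
  have "(\<integral>y. (vec_inner p u y)\<^sup>2 \<partial>\<nu>) = (\<integral>y. (\<Sum>k<p. \<Sum>l<p. (u k * u l) * (y k * y l)) \<partial>\<nu>)"
    by (simp add: vec_inner_def power2_eq_square sum_product mult_ac)
  also have "\<dots> = (\<Sum>k<p. \<Sum>l<p. (u k * u l) * (\<integral>y. y k * y l \<partial>\<nu>))"
  proof -
    have "integrable \<nu> (\<lambda>y. \<Sum>l<p. (u k * u l) * (y k * y l))" if "k < p" for k
      using that by (intro Bochner_Integration.integrable_sum int) auto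
    thus ?thesis using int by (simp add: Bochner_Integration.integral_sum del: integrable_mult_right_iff)
  qed
  also have "\<dots> = (\<Sum>k<p. \<Sum>l<p. if l = k then u k * u l / p else 0)"
    by (intro sum.cong refl) (auto simp: second_moment)
  also have "\<dots> = vec_inner p u u / p"
    by (simp add: vec_inner_def sum_divide_distrib)
  finally show ?thesis .
qed

text \<open>
  The only control on the tails: between unit vectors the inner product is at most 1 in absolute
  value, so the fourth power is dominated by the square.
\<close>

lemma integral_inner_fourth_le:
  assumes "vec_inner p u u = 1"
  shows "(\<integral>y. vec_inner p u y ^ 4 \<partial>\<nu>) \<le> 1 / p"
proof -
  have "(\<integral>y. vec_inner p u y ^ 4 \<partial>\<nu>) \<le> (\<integral>y. (vec_inner p u y)\<^sup>2 \<partial>\<nu>)"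
  proof (rule integral_mono_AE[OF integrable_inner_power integrable_inner_power])
    show "AE y in \<nu>. vec_inner p u y ^ 4 \<le> (vec_inner p u y)\<^sup>2"
      using unit_AE
    proof eventually_elim
      fix y assume "vec_inner p y y = 1"
      hence "(vec_inner p u y)\<^sup>2 \<le> 1" using vec_inner_square_le[of p u y] assms by simp
      hence "(vec_inner p u y)\<^sup>2 * (vec_inner p u y)\<^sup>2 \<le> 1 * (vec_inner p u y)\<^sup>2"
        by (intro mult_right_mono) auto
      thus "vec_inner p u y ^ 4 \<le> (vec_inner p u y)\<^sup>2" by (simp flip: power_add)
    qed
  qed
  thus ?thesis by (simp add: integral_inner_square assms)
qed

lemma integral_add_inner_square:
  "(\<integral>y. (a + vec_inner p u y)\<^sup>2 \<partial>\<nu>) = a\<^sup>2 + vec_inner p u u / p"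
proof -
  have "(\<integral>y. (a + vec_inner p u y)\<^sup>2 \<partial>\<nu>) = (\<integral>y. a\<^sup>2 + 2 * a * vec_inner p u y + (vec_inner p u y)\<^sup>2 \<partial>\<nu>)"
    by (simp add: power2_sum algebra_simps)
  also have "\<dots> = a\<^sup>2 + vec_inner p u u / p"
    using integrable_inner_power[of u 1] integrable_inner_power[of u 2]
    by (simp add: integral_inner integral_inner_square prob_space)
  finally show ?thesis .
qed

text \<open>
  One step of the recursion for fourth moments of sums; by symmetry the odd powers of the new summand
  drop out of the binomial expansion.
\<close>

lemma integral_add_inner_fourth_le:
  assumes "vec_inner p u u = 1"
  shows "(\<integral>y. (a + vec_inner p u y) ^ 4 \<partial>\<nu>) \<le> a ^ 4 + 6 * a\<^sup>2 / p + 1 / p"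
proof -
  have "(\<integral>y. (a + vec_inner p u y) ^ 4 \<partial>\<nu>) = (\<integral>y. a ^ 4 + 4 * a ^ 3 * vec_inner p u y
      + 6 * a\<^sup>2 * (vec_inner p u y)\<^sup>2 + 4 * a * vec_inner p u y ^ 3 + vec_inner p u y ^ 4 \<partial>\<nu>)"
    by (intro Bochner_Integration.integral_cong refl) (simp add: algebra_simps eval_nat_numeral)
  also have "\<dots> = a ^ 4 + 6 * a\<^sup>2 / p + (\<integral>y. vec_inner p u y ^ 4 \<partial>\<nu>)"
    using integrable_inner_power[of u 1] integrable_inner_power[of u 2]
      integrable_inner_power[of u 3] integrable_inner_power[of u 4]
    by (simp add: integral_inner integral_inner_square integral_inner_cube prob_space assms)
  finally show ?thesis using integral_inner_fourth_le[OF assms] by simp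
qed

end

section \<open>Sums of vectors and sums over pairs\<close>

definition vec_sum :: "nat \<Rightarrow> (nat \<Rightarrow> nat \<Rightarrow> real) \<Rightarrow> nat \<Rightarrow> real" where
  "vec_sum m x = (\<lambda>k. \<Sum>i\<in>{1..m}. x i k)"

definition inner_pair_sum :: "nat \<Rightarrow> nat \<Rightarrow> (nat \<Rightarrow> nat \<Rightarrow> real) \<Rightarrow> real" where
  "inner_pair_sum p m x = (\<Sum>j\<in>{1..m}. \<Sum>i\<in>{1..<j}. vec_inner p (x i) (x j))"

lemma vec_inner_vec_sum: "vec_inner p (vec_sum m x) y = (\<Sum>i\<in>{1..m}. vec_inner p (x i) y)"
  unfolding vec_sum_def by (rule vec_inner_sum_left)

lemma vec_inner_vec_sum_upd:
  "vec_inner p (vec_sum (Suc m) (x(Suc m := y))) u = vec_inner p (vec_sum m x) u + vec_inner p u y"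
  by (simp add: vec_inner_vec_sum vec_inner_commute[of p u])

lemma inner_pair_sum_Suc:
  "inner_pair_sum p (Suc m) x = inner_pair_sum p m x + vec_inner p (vec_sum m x) (x (Suc m))"
  by (simp add: inner_pair_sum_def vec_inner_vec_sum atLeastLessThanSuc_atLeastAtMost)

text \<open>
  The martingale recursion. The sample is extended by a function update because this is the form in
  which integration over the last factor of a product measure produces it.
\<close>

lemma inner_pair_sum_upd:
  "inner_pair_sum p (Suc m) (x(Suc m := y)) = inner_pair_sum p m x + vec_inner p (vec_sum m x) y"
proof -
  have "inner_pair_sum p m (x(Suc m := y)) = inner_pair_sum p m x"
    unfolding inner_pair_sum_def by (intro sum.cong refl) auto
  moreover have "vec_sum m (x(Suc m := y)) = vec_sum m x"
    unfolding vec_sum_def by (intro ext sum.cong refl) auto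
  ultimately show ?thesis by (simp add: inner_pair_sum_Suc)
qed

lemma vec_sum_self_inner:
  "vec_inner p (vec_sum m x) (vec_sum m x) = (\<Sum>i\<in>{1..m}. vec_inner p (x i) (x i)) + 2 * inner_pair_sum p m x"
proof (induction m)
  case 0
  show ?case by (simp add: vec_inner_def vec_sum_def inner_pair_sum_def)
next
  case (Suc m)
  have "vec_sum (Suc m) x = (\<lambda>k. vec_sum m x k + x (Suc m) k)"
    by (simp add: vec_sum_def)
  hence "vec_inner p (vec_sum (Suc m) x) (vec_sum (Suc m) x) =
      vec_inner p (vec_sum m x) (vec_sum m x) + 2 * vec_inner p (vec_sum m x) (x (Suc m))
      + vec_inner p (x (Suc m)) (x (Suc m))"
    by (simp add: vec_inner_def algebra_simps sum.distrib sum_distrib_left)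
  thus ?case by (simp add: Suc.IH inner_pair_sum_Suc)
qed

section \<open>Samples from an isotropic law and the moments of their pair sums\<close>

context isotropic_sphere_law
begin

definition sample :: "nat \<Rightarrow> (nat \<Rightarrow> nat \<Rightarrow> real) measure" where
  "sample m = Pi\<^sub>M {1..m} (\<lambda>_. \<nu>)"

definition unit_sample :: "nat \<Rightarrow> (nat \<Rightarrow> nat \<Rightarrow> real) \<Rightarrow> bool" where
  "unit_sample m x \<longleftrightarrow> (\<forall>i\<in>{1..m}. vec_inner p (x i) (x i) = 1)"

lemma prob_space_sample: "prob_space (sample m)"
  unfolding sample_def by (intro prob_space_PiM prob_space_axioms)

lemma AE_unit_sample: "AE x in sample m. unit_sample m x"
  unfolding unit_sample_def sample_def
  by (intro AE_finite_allI AE_PiM_component prob_space_axioms unit_AE) auto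

lemma integrable_bounded_on_unit_sample:
  fixes f :: "(nat \<Rightarrow> nat \<Rightarrow> real) \<Rightarrow> 'b::{banach, second_countable_topology}"
  assumes "f \<in> borel_measurable (sample m)" and "\<And>x. unit_sample m x \<Longrightarrow> norm (f x) \<le> B"
  shows "integrable (sample m) f"
proof -
  interpret sample: prob_space "sample m" by (rule prob_space_sample)
  show ?thesis using AE_unit_sample[of m]
    by (intro sample.integrable_const_bound[of _ B] assms) (auto elim!: eventually_mono dest: assms(2))
qed

lemma integral_sample_Suc:
  fixes f :: "(nat \<Rightarrow> nat \<Rightarrow> real) \<Rightarrow> 'b::{banach, second_countable_topology}"
  assumes "integrable (sample (Suc m)) f"
  shows "(\<integral>x. f x \<partial>sample (Suc m)) = (\<integral>x. \<integral>y. f (x(Suc m := y)) \<partial>\<nu> \<partial>sample m)"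
proof -
  interpret samples: product_prob_space "\<lambda>_::nat. \<nu>" by standard
  show ?thesis
    using samples.product_integral_insert[of "{1..m}" "Suc m" f] assms
    by (simp add: sample_def atLeastAtMostSuc_conv)
qed

lemma sample_component_measurable [measurable (raw)]:
  assumes "f \<in> N \<rightarrow>\<^sub>M sample m" "i \<in> {1..m}"
  shows "(\<lambda>\<omega>. f \<omega> i) \<in> N \<rightarrow>\<^sub>M borel_vec p"
  using measurable_compose[OF assms(1)[unfolded sample_def] measurable_component_singleton[OF assms(2), of "\<lambda>_. \<nu>"]]
  by (simp cong: measurable_cong_sets add: sets_eq)

lemma vec_sum_inner_measurable [measurable]:
  assumes "f \<in> N \<rightarrow>\<^sub>M sample m" "g \<in> N \<rightarrow>\<^sub>M borel_vec p"
  shows "(\<lambda>\<omega>. vec_inner p (vec_sum m (f \<omega>)) (g \<omega>)) \<in> borel_measurable N"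
  unfolding vec_inner_vec_sum
  by (intro borel_measurable_sum vec_inner_measurable sample_component_measurable[of _ _ m] assms)

lemma inner_pair_sum_measurable [measurable]: "inner_pair_sum p m \<in> borel_measurable (sample m)"
  unfolding inner_pair_sum_def
  by (intro borel_measurable_sum vec_inner_measurable sample_component_measurable[of "\<lambda>x. x" _ m]) auto

lemma vec_sum_inner_const_measurable [measurable]: "(\<lambda>x. vec_inner p (vec_sum m x) u) \<in> borel_measurable (sample m)"
proof -
  have "(\<lambda>x. vec_inner p (vec_sum m x) (restrict u {..<p})) \<in> borel_measurable (sample m)"
    by (intro vec_sum_inner_measurable measurable_const) (auto simp: space_PiM)
  thus ?thesis by (simp add: vec_inner_def)
qed

lemma abs_vec_sum_inner_le:
  assumes "unit_sample m x" "vec_inner p u u = 1"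
  shows "\<bar>vec_inner p (vec_sum m x) u\<bar> \<le> m"
proof -
  have "\<bar>vec_inner p (x i) u\<bar> \<le> 1" if "i \<in> {1..m}" for i
    using abs_vec_inner_le[OF assms(2), of "x i"] that assms(1) by (simp add: unit_sample_def)
  hence "\<bar>vec_inner p (vec_sum m x) u\<bar> \<le> (\<Sum>i\<in>{1..m}. 1)"
    unfolding vec_inner_vec_sum by (intro order.trans[OF sum_abs] sum_mono) auto
  thus ?thesis by simp
qed

text \<open>
  On the sphere the diagonal terms are constant, so the fluctuation of the conditional variance of the
  next increment is governed by the pair sum itself.
\<close>

lemma vec_sum_self_inner_unit:
  assumes "unit_sample m x"
  shows "vec_inner p (vec_sum m x) (vec_sum m x) = m + 2 * inner_pair_sum p m x"
  using assms by (simp add: vec_sum_self_inner unit_sample_def)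

lemma abs_inner_pair_sum_le:
  assumes "unit_sample m x"
  shows "\<bar>inner_pair_sum p m x\<bar> \<le> (real m)\<^sup>2"
proof -
  have "\<bar>vec_inner p (x i) (x j)\<bar> \<le> 1" if "i \<in> {1..m}" "j \<in> {1..m}" for i j
    using abs_vec_inner_le[of "x j" "x i"] that assms by (simp add: unit_sample_def)
  hence "\<bar>inner_pair_sum p m x\<bar> \<le> (\<Sum>j\<in>{1..m}. \<Sum>i\<in>{1..<j}. 1)"
    unfolding inner_pair_sum_def by (intro order.trans[OF sum_abs] sum_mono) auto
  also have "\<dots> \<le> (\<Sum>j\<in>{1..m}. real m)"
    by (intro sum_mono) auto
  finally show ?thesis by (simp add: power2_eq_square)
qed

lemma integrable_inner_pair_sum_power: "integrable (sample m) (\<lambda>x. inner_pair_sum p m x ^ q)"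
  by (rule integrable_bounded_on_unit_sample[of _ _ "((real m)\<^sup>2) ^ q"])
     (measurable, auto simp: power_abs intro!: power_mono abs_inner_pair_sum_le)

lemma integral_inner_pair_sum: "(\<integral>x. inner_pair_sum p m x \<partial>sample m) = 0"
proof (induction m)
  case 0
  show ?case by (simp add: inner_pair_sum_def)
next
  case (Suc m)
  have "(\<integral>x. inner_pair_sum p (Suc m) x \<partial>sample (Suc m)) =
      (\<integral>x. \<integral>y. inner_pair_sum p m x + vec_inner p (vec_sum m x) y \<partial>\<nu> \<partial>sample m)"
    using integral_sample_Suc[OF integrable_inner_pair_sum_power[of "Suc m" 1]]
    by (simp add: inner_pair_sum_upd)
  also have "\<dots> = (\<integral>x. inner_pair_sum p m x \<partial>sample m)"
    using integrable_inner_power[of _ 1] by (simp add: integral_inner prob_space)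
  finally show ?case by (simp add: Suc.IH)
qed

lemma integral_inner_pair_sum_square:
  "(\<integral>x. (inner_pair_sum p m x)\<^sup>2 \<partial>sample m) = real m * (real m - 1) / (2 * p)"
proof (induction m)
  case 0
  show ?case by (simp add: inner_pair_sum_def)
next
  case (Suc m)
  interpret sample: prob_space "sample m" by (rule prob_space_sample)
  have "(\<integral>x. (inner_pair_sum p (Suc m) x)\<^sup>2 \<partial>sample (Suc m)) =
      (\<integral>x. \<integral>y. (inner_pair_sum p m x + vec_inner p (vec_sum m x) y)\<^sup>2 \<partial>\<nu> \<partial>sample m)"
    using integral_sample_Suc[OF integrable_inner_pair_sum_power[of "Suc m" 2]]
    by (simp add: inner_pair_sum_upd)
  also have "\<dots> = (\<integral>x. (inner_pair_sum p m x)\<^sup>2 + vec_inner p (vec_sum m x) (vec_sum m x) / p \<partial>sample m)"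
    by (simp add: integral_add_inner_square)
  also have "\<dots> = (\<integral>x. (inner_pair_sum p m x)\<^sup>2 + (m + 2 * inner_pair_sum p m x) / p \<partial>sample m)"
  proof (rule integral_cong_AE)
    show "(\<lambda>x. (inner_pair_sum p m x)\<^sup>2 + vec_inner p (vec_sum m x) (vec_sum m x) / p) \<in> borel_measurable (sample m)"
      unfolding vec_sum_self_inner
      by (intro borel_measurable_add borel_measurable_power borel_measurable_divide borel_measurable_times
          borel_measurable_sum borel_measurable_const inner_pair_sum_measurable vec_inner_measurable
          sample_component_measurable[of "\<lambda>x. x" _ m]) auto
    show "AE x in sample m. (inner_pair_sum p m x)\<^sup>2 + vec_inner p (vec_sum m x) (vec_sum m x) / p =
        (inner_pair_sum p m x)\<^sup>2 + (m + 2 * inner_pair_sum p m x) / p"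
      using AE_unit_sample[of m] by eventually_elim (simp add: vec_sum_self_inner_unit)
  qed measurable
  also have "\<dots> = real m * (real m - 1) / (2 * p) + m / p"
    using integrable_inner_pair_sum_power[of m 1] integrable_inner_pair_sum_power[of m 2]
    by (simp add: add_divide_distrib Suc.IH integral_inner_pair_sum sample.prob_space)
  also have "\<dots> = real (Suc m) * (real (Suc m) - 1) / (2 * p)"
    by (cases "p = 0") (simp_all add: field_simps)
  finally show ?case .
qed

lemma integrable_vec_sum_inner_power:
  assumes "vec_inner p u u = 1"
  shows "integrable (sample m) (\<lambda>x. vec_inner p (vec_sum m x) u ^ q)"
  by (rule integrable_bounded_on_unit_sample[of _ _ "real m ^ q"])
     (measurable, auto simp: power_abs intro!: power_mono abs_vec_sum_inner_le assms)

lemma integral_vec_sum_inner_square: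
  assumes "vec_inner p u u = 1"
  shows "(\<integral>x. (vec_inner p (vec_sum m x) u)\<^sup>2 \<partial>sample m) = m / p"
proof (induction m)
  case 0
  show ?case by (simp add: vec_inner_def vec_sum_def)
next
  case (Suc m)
  interpret sample: prob_space "sample m" by (rule prob_space_sample)
  have "(\<integral>x. (vec_inner p (vec_sum (Suc m) x) u)\<^sup>2 \<partial>sample (Suc m)) =
      (\<integral>x. (vec_inner p (vec_sum m x) u)\<^sup>2 + 1 / p \<partial>sample m)"
    using integral_sample_Suc[OF integrable_vec_sum_inner_power[OF assms, of "Suc m" 2]]
    by (simp add: vec_inner_vec_sum_upd integral_add_inner_square assms)
  also have "\<dots> = m / p + 1 / p"
    using integrable_vec_sum_inner_power[OF assms, of m 2] by (simp add: Suc.IH sample.prob_space)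
  finally show ?case by (simp add: add_divide_distrib)
qed

text \<open>
  Along a fixed direction the inner products are i.i.d. and symmetric with second moment \<open>1/p\<close> and fourth
  moment at most \<open>1/p\<close>; a sum of \<open>m\<close> of them has fourth moment at most
  \<open>m/p\<close> from the diagonal and \<open>3 (m/p)\<^sup>2\<close> from the pairs.
\<close>

lemma integral_vec_sum_inner_fourth_le:
  assumes "vec_inner p u u = 1"
  shows "(\<integral>x. vec_inner p (vec_sum m x) u ^ 4 \<partial>sample m) \<le> m / p + 3 * (m / p)\<^sup>2"
proof (induction m)
  case 0
  show ?case by (simp add: vec_inner_def vec_sum_def)
next
  case (Suc m)
  interpret sample: prob_space "sample m" by (rule prob_space_sample)
  note int = integrable_vec_sum_inner_power[OF assms]
  have "(\<integral>x. vec_inner p (vec_sum (Suc m) x) u ^ 4 \<partial>sample (Suc m)) =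
      (\<integral>x. \<integral>y. (vec_inner p (vec_sum m x) u + vec_inner p u y) ^ 4 \<partial>\<nu> \<partial>sample m)"
    using integral_sample_Suc[OF int[of "Suc m" 4]] by (simp add: vec_inner_vec_sum_upd)
  also have "\<dots> \<le> (\<integral>x. vec_inner p (vec_sum m x) u ^ 4 + 6 * (vec_inner p (vec_sum m x) u)\<^sup>2 / p + 1 / p \<partial>sample m)"
    using int[of m 4] int[of m 2] assms
    by (intro integral_mono' integral_add_inner_fourth_le) auto
  also have "\<dots> = (\<integral>x. vec_inner p (vec_sum m x) u ^ 4 \<partial>sample m) + 6 * (m / p) / p + 1 / p"
    using int[of m 4] int[of m 2] by (simp add: integral_vec_sum_inner_square assms sample.prob_space)
  also have "\<dots> \<le> m / p + 3 * (m / p)\<^sup>2 + 6 * (m / p) / p + 1 / p"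
    using Suc.IH by simp
  also have "\<dots> \<le> Suc m / p + 3 * (Suc m / p)\<^sup>2"
    by (cases "p = 0") (simp_all add: field_simps power2_eq_square)
  finally show ?case .
qed

text \<open>
  The increment \<open>S\<^sub>m \<bullet> X\<^sub>m\<^sub>+\<^sub>1\<close> is easy to control when the new vector is held fixed and the old ones
  vary, whereas the recursion integrates in the opposite order. Fubini's theorem exchanges the two.
\<close>

lemma integral_increment_fourth_le:
  "(\<integral>x. \<integral>y. vec_inner p (vec_sum m x) y ^ 4 \<partial>\<nu> \<partial>sample m) \<le> m / p + 3 * (m / p)\<^sup>2"
  and integrable_increment_fourth:
  "integrable (sample m) (\<lambda>x. \<integral>y. vec_inner p (vec_sum m x) y ^ 4 \<partial>\<nu>)"
proof -
  interpret sample: prob_space "sample m" by (rule prob_space_sample)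
  interpret pair: pair_prob_space "sample m" \<nu> ..
  have [measurable]: "(\<lambda>z. vec_inner p (vec_sum m (fst z)) (snd z)) \<in> borel_measurable (sample m \<Otimes>\<^sub>M \<nu>)"
    by measurable
  have AE: "AE z in sample m \<Otimes>\<^sub>M \<nu>. \<bar>vec_inner p (vec_sum m (fst z)) (snd z)\<bar> \<le> m"
  proof (rule pair.AE_pair_measure)
    show "AE x in sample m. AE y in \<nu>. \<bar>vec_inner p (vec_sum m (fst (x, y))) (snd (x, y))\<bar> \<le> m"
      using AE_unit_sample[of m]
    proof eventually_elim
      case (elim x)
      show ?case using unit_AE by eventually_elim (simp add: abs_vec_sum_inner_le elim)
    qed
  qed measurable
  have int: "integrable (sample m \<Otimes>\<^sub>M \<nu>) (case_prod (\<lambda>x y. vec_inner p (vec_sum m x) y ^ 4))"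
    unfolding case_prod_beta
  proof (rule pair.integrable_const_bound[of _ "real m ^ 4"])
    show "AE z in sample m \<Otimes>\<^sub>M \<nu>. norm (vec_inner p (vec_sum m (fst z)) (snd z) ^ 4) \<le> real m ^ 4"
      using AE by eventually_elim (simp only: real_norm_def power_abs, intro power_mono, auto)
  qed measurable
  show "integrable (sample m) (\<lambda>x. \<integral>y. vec_inner p (vec_sum m x) y ^ 4 \<partial>\<nu>)"
    using pair.integrable_fst'[OF int] by simp
  have "(\<integral>x. \<integral>y. vec_inner p (vec_sum m x) y ^ 4 \<partial>\<nu> \<partial>sample m) =
      (\<integral>y. \<integral>x. vec_inner p (vec_sum m x) y ^ 4 \<partial>sample m \<partial>\<nu>)"
    using pair.Fubini_integral[OF int] by simp
  also have "\<dots> \<le> (\<integral>y. m / p + 3 * (m / p)\<^sup>2 \<partial>\<nu>)"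
  proof (rule integral_mono_AE)
    show "integrable \<nu> (\<lambda>y. \<integral>x. vec_inner p (vec_sum m x) y ^ 4 \<partial>sample m)"
      using pair.integrable_snd[OF int] by simp
    show "AE y in \<nu>. (\<integral>x. vec_inner p (vec_sum m x) y ^ 4 \<partial>sample m) \<le> m / p + 3 * (m / p)\<^sup>2"
      using unit_AE by eventually_elim (rule integral_vec_sum_inner_fourth_le)
  qed simp
  finally show "(\<integral>x. \<integral>y. vec_inner p (vec_sum m x) y ^ 4 \<partial>\<nu> \<partial>sample m) \<le> m / p + 3 * (m / p)\<^sup>2"
    by (simp add: prob_space)
qed

lemma integral_abs_inner_pair_sum_le: "(\<integral>x. \<bar>inner_pair_sum p m x\<bar> \<partial>sample m) \<le> m / sqrt p"
proof -
  interpret sample: prob_space "sample m" by (rule prob_space_sample)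
  have int: "integrable (sample m) (\<lambda>x. \<bar>inner_pair_sum p m x\<bar>)"
    "integrable (sample m) (\<lambda>x. \<bar>inner_pair_sum p m x\<bar>\<^sup>2)"
    using integrable_inner_pair_sum_power[of m 1] integrable_inner_pair_sum_power[of m 2] by simp_all
  have "(\<integral>x. \<bar>inner_pair_sum p m x\<bar> \<partial>sample m)\<^sup>2 \<le> (\<integral>x. \<bar>inner_pair_sum p m x\<bar>\<^sup>2 \<partial>sample m)"
    using sample.variance_positive[of "\<lambda>x. \<bar>inner_pair_sum p m x\<bar>"] sample.variance_eq[OF int] by simp
  also have "\<dots> = real m * (real m - 1) / (2 * p)"
    by (simp add: integral_inner_pair_sum_square)
  also have "\<dots> \<le> (real m)\<^sup>2 / p"
    by (cases "p = 0") (simp_all add: field_simps power2_eq_square)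
  finally have "(\<integral>x. \<bar>inner_pair_sum p m x\<bar> \<partial>sample m) \<le> sqrt ((real m)\<^sup>2 / p)"
    by (rule real_le_rsqrt)
  thus ?thesis by (simp add: real_sqrt_divide)
qed

section \<open>Characteristic functions of pair sums\<close>

text \<open>
  The conditional characteristic function of the increment is compared with the Gaussian factor of
  variance \<open>m / p\<close>. The three terms of the bound come from linearizing the exponential, from the deviation
  of the conditional variance \<open>|S\<^sub>m|\<^sup>2 / p\<close> from \<open>m / p\<close>, and from the Taylor remainder of the cosine.
\<close>

lemma abs_integral_cos_minus_exp_le:
  assumes "unit_sample m x"
  shows "\<bar>(\<integral>y. cos (\<theta> * vec_inner p (vec_sum m x) y) \<partial>\<nu>) - exp (- (\<theta>\<^sup>2 * real m / (2 * p)))\<bar>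
    \<le> (\<theta>\<^sup>2 * real m / (2 * p))\<^sup>2 + \<theta>\<^sup>2 / p * \<bar>inner_pair_sum p m x\<bar>
       + \<theta> ^ 4 / 24 * (\<integral>y. vec_inner p (vec_sum m x) y ^ 4 \<partial>\<nu>)"
proof -
  define u where "u = vec_sum m x"
  define b where "b = \<theta>\<^sup>2 * real m / (2 * p)"
  let ?C = "\<integral>y. cos (\<theta> * vec_inner p u y) \<partial>\<nu>" and ?q = "\<theta>\<^sup>2 / 2 * (vec_inner p u u / p)"
  have int: "integrable \<nu> (\<lambda>y. cos (\<theta> * vec_inner p u y))"
  proof (rule integrable_bounded_on_sphere[of _ 1])
    show "(\<lambda>y. cos (\<theta> * vec_inner p u y)) \<in> borel_measurable \<nu>" by measurable
  qed simp
  have quad: "integrable \<nu> (\<lambda>y. (vec_inner p u y)\<^sup>2)" "integrable \<nu> (\<lambda>y. vec_inner p u y ^ 4)"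
    using integrable_inner_power by simp_all
  have "?C - (1 - ?q) = (\<integral>y. cos (\<theta> * vec_inner p u y) - (1 - (\<theta> * vec_inner p u y)\<^sup>2 / 2) \<partial>\<nu>)"
    using int quad(1)
    by (simp add: power_mult_distrib integral_inner_square prob_space)
  also have "\<bar>\<dots>\<bar> \<le> (\<integral>y. \<bar>cos (\<theta> * vec_inner p u y) - (1 - (\<theta> * vec_inner p u y)\<^sup>2 / 2)\<bar> \<partial>\<nu>)"
    by (rule integral_abs_bound)
  also have "\<dots> \<le> (\<integral>y. (\<theta> * vec_inner p u y) ^ 4 / 24 \<partial>\<nu>)"
    using int quad
    by (intro integral_mono abs_cos_minus_quadratic_le) (simp_all add: power_mult_distrib)
  finally have 1: "\<bar>?C - (1 - ?q)\<bar> \<le> \<theta> ^ 4 / 24 * (\<integral>y. vec_inner p u y ^ 4 \<partial>\<nu>)"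
    by (simp add: power_mult_distrib)
  have "?q - b = \<theta>\<^sup>2 / p * inner_pair_sum p m x"
    by (simp add: u_def vec_sum_self_inner_unit[OF assms] b_def add_divide_distrib distrib_left)
  hence 2: "\<bar>?q - b\<bar> = \<theta>\<^sup>2 / p * \<bar>inner_pair_sum p m x\<bar>"
    by (simp add: abs_mult)
  have 3: "\<bar>1 - b - exp (- b)\<bar> \<le> b\<^sup>2"
    by (rule abs_exp_uminus_minus_linear_le) (simp add: b_def)
  show ?thesis using 1 2 3 unfolding u_def[symmetric] b_def[symmetric] by linarith
qed

definition pair_sum_char :: "nat \<Rightarrow> real \<Rightarrow> complex" where
  "pair_sum_char m \<theta> = (CLINT x|sample m. iexp (\<theta> * inner_pair_sum p m x))"

text \<open>
  Symmetry makes the conditional characteristic function real. The expansion therefore has no cubic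
  term, and a fourth moment bound suffices.
\<close>

lemma integral_iexp_inner:
  "(CLINT y|\<nu>. iexp (\<theta> * vec_inner p u y)) = complex_of_real (\<integral>y. cos (\<theta> * vec_inner p u y) \<partial>\<nu>)"
proof -
  have int: "integrable \<nu> (\<lambda>y. cos (\<theta> * vec_inner p u y))" "integrable \<nu> (\<lambda>y. sin (\<theta> * vec_inner p u y))"
    by (rule integrable_bounded_on_sphere[of _ 1]; (measurable; simp))+
  have "(\<integral>y. sin (\<theta> * vec_inner p u y) \<partial>\<nu>) = 0"
    by (rule integral_odd_eq_0) (measurable, simp add: vec_inner_uminus_right)
  moreover have "(CLINT y|\<nu>. iexp (\<theta> * vec_inner p u y)) = (CLINT y|\<nu>.
      complex_of_real (cos (\<theta> * vec_inner p u y)) + \<i> * complex_of_real (sin (\<theta> * vec_inner p u y)))"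
    by (intro Bochner_Integration.integral_cong refl) (simp only: exp_Euler cos_of_real sin_of_real)
  ultimately show ?thesis using int by (simp del: of_real_mult)
qed

lemma pair_sum_char_Suc:
  "pair_sum_char (Suc m) \<theta> = (CLINT x|sample m. iexp (\<theta> * inner_pair_sum p m x) *
     complex_of_real (\<integral>y. cos (\<theta> * vec_inner p (vec_sum m x) y) \<partial>\<nu>))"
proof -
  have "integrable (sample (Suc m)) (\<lambda>x. iexp (\<theta> * inner_pair_sum p (Suc m) x))"
  proof (rule integrable_bounded_on_unit_sample[of _ _ 1])
    show "(\<lambda>x. iexp (\<theta> * inner_pair_sum p (Suc m) x)) \<in> borel_measurable (sample (Suc m))" by measurable
  qed (simp del: of_real_mult)
  hence "pair_sum_char (Suc m) \<theta> = (CLINT x|sample m. CLINT y|\<nu>.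
      iexp (\<theta> * (inner_pair_sum p m x + vec_inner p (vec_sum m x) y)))"
    unfolding pair_sum_char_def by (simp only: integral_sample_Suc inner_pair_sum_upd)
  also have "\<dots> = (CLINT x|sample m. CLINT y|\<nu>.
      iexp (\<theta> * inner_pair_sum p m x) * iexp (\<theta> * vec_inner p (vec_sum m x) y))"
    by (simp add: distrib_left exp_add)
  also have "\<dots> = (CLINT x|sample m. iexp (\<theta> * inner_pair_sum p m x) *
     complex_of_real (\<integral>y. cos (\<theta> * vec_inner p (vec_sum m x) y) \<partial>\<nu>))"
    by (simp only: integral_mult_right_zero integral_iexp_inner)
  finally show ?thesis .
qed

text \<open>
  The factor \<open>exp (i \<theta> T\<^sub>m)\<close> has modulus 1, so it is enough that the conditional characteristic function
  of the increment be close to the Gaussian factor in mean; its fluctuations need not be controlled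
  path by path.
\<close>

lemma norm_pair_sum_char_step_le:
  "norm (pair_sum_char (Suc m) \<theta> - complex_of_real (exp (- (\<theta>\<^sup>2 * real m / (2 * p)))) * pair_sum_char m \<theta>)
    \<le> (\<theta>\<^sup>2 * real m / (2 * p))\<^sup>2 + \<theta>\<^sup>2 / p * (real m / sqrt p) + \<theta> ^ 4 / 24 * (real m / p + 3 * (real m / p)\<^sup>2)"
proof -
  interpret sample: prob_space "sample m" by (rule prob_space_sample)
  define b where "b = \<theta>\<^sup>2 * real m / (2 * p)"
  define C where "C x = (\<integral>y. cos (\<theta> * vec_inner p (vec_sum m x) y) \<partial>\<nu>)" for x
  define F where "F x = (\<integral>y. vec_inner p (vec_sum m x) y ^ 4 \<partial>\<nu>)" for x
  let ?e = "\<lambda>x. iexp (\<theta> * inner_pair_sum p m x)"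
  have C_measurable [measurable]: "C \<in> borel_measurable (sample m)"
    unfolding C_def by measurable
  have C_le: "\<bar>C x\<bar> \<le> 1" for x
  proof -
    have "\<bar>C x\<bar> \<le> (\<integral>y. \<bar>cos (\<theta> * vec_inner p (vec_sum m x) y)\<bar> \<partial>\<nu>)"
      unfolding C_def by (rule integral_abs_bound)
    also have "\<dots> \<le> (\<integral>y. 1 \<partial>\<nu>)" by (intro integral_mono') auto
    finally show ?thesis by (simp add: prob_space)
  qed
  have int: "integrable (sample m) (\<lambda>x. ?e x * complex_of_real (C x))"
      "integrable (sample m) (\<lambda>x. complex_of_real (exp (- b)) * ?e x)"
    using C_le
    by (auto intro!: sample.integrable_const_bound[of _ 1] integrable_mult_right
             simp: norm_mult simp del: of_real_mult)
  have "pair_sum_char (Suc m) \<theta> - complex_of_real (exp (- b)) * pair_sum_char m \<theta>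
      = (CLINT x|sample m. ?e x * complex_of_real (C x)) - (CLINT x|sample m. complex_of_real (exp (- b)) * ?e x)"
    by (simp only: pair_sum_char_Suc C_def) (simp add: pair_sum_char_def)
  also have "\<dots> = (CLINT x|sample m. ?e x * complex_of_real (C x) - complex_of_real (exp (- b)) * ?e x)"
    using int by (rule Bochner_Integration.integral_diff[symmetric])
  also have "\<dots> = (CLINT x|sample m. ?e x * complex_of_real (C x - exp (- b)))"
    by (simp add: algebra_simps)
  also have "norm \<dots> \<le> (\<integral>x. norm (?e x * complex_of_real (C x - exp (- b))) \<partial>sample m)"
    by (rule integral_norm_bound)
  also have "\<dots> = (\<integral>x. \<bar>C x - exp (- b)\<bar> \<partial>sample m)"
    by (simp only: norm_mult norm_exp_i_times norm_of_real mult_1)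
  also have "\<dots> \<le> (\<integral>x. b\<^sup>2 + \<theta>\<^sup>2 / p * \<bar>inner_pair_sum p m x\<bar> + \<theta> ^ 4 / 24 * F x \<partial>sample m)"
  proof (rule integral_mono_AE)
    show "integrable (sample m) (\<lambda>x. \<bar>C x - exp (- b)\<bar>)"
      using C_le by (intro sample.integrable_const_bound[of _ "1 + exp (- b)"])
        (auto intro!: AE_I2 order.trans[OF abs_triangle_ineq4])
    show "integrable (sample m) (\<lambda>x. b\<^sup>2 + \<theta>\<^sup>2 / p * \<bar>inner_pair_sum p m x\<bar> + \<theta> ^ 4 / 24 * F x)"
      using integrable_increment_fourth[of m] integrable_inner_pair_sum_power[of m 1] by (simp add: F_def)
    show "AE x in sample m. \<bar>C x - exp (- b)\<bar> \<le> b\<^sup>2 + \<theta>\<^sup>2 / p * \<bar>inner_pair_sum p m x\<bar> + \<theta> ^ 4 / 24 * F x"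
      using AE_unit_sample[of m] unfolding C_def F_def b_def
      by eventually_elim (rule abs_integral_cos_minus_exp_le)
  qed
  also have "\<dots> = b\<^sup>2 + \<theta>\<^sup>2 / p * (\<integral>x. \<bar>inner_pair_sum p m x\<bar> \<partial>sample m) + \<theta> ^ 4 / 24 * (\<integral>x. F x \<partial>sample m)"
    using integrable_increment_fourth[of m] integrable_inner_pair_sum_power[of m 1]
    by (simp add: F_def sample.prob_space)
  also have "\<dots> \<le> b\<^sup>2 + \<theta>\<^sup>2 / p * (real m / sqrt p) + \<theta> ^ 4 / 24 * (real m / p + 3 * (real m / p)\<^sup>2)"
    unfolding F_def
    by (intro add_mono mult_left_mono integral_abs_inner_pair_sum_le integral_increment_fourth_le order.refl) auto
  finally show ?thesis by (simp add: b_def)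
qed

lemma norm_pair_sum_char_minus_gaussian_le:
  "norm (pair_sum_char n \<theta> - complex_of_real (exp (- (\<Sum>m<n. \<theta>\<^sup>2 * real m / (2 * p)))))
    \<le> (\<Sum>m<n. (\<theta>\<^sup>2 * real m / (2 * p))\<^sup>2 + \<theta>\<^sup>2 / p * (real m / sqrt p) + \<theta> ^ 4 / 24 * (real m / p + 3 * (real m / p)\<^sup>2))"
proof (induction n)
  case 0
  interpret sample: prob_space "sample 0" by (rule prob_space_sample)
  show ?case by (simp add: pair_sum_char_def inner_pair_sum_def sample.prob_space)
next
  case (Suc n)
  define a where "a = (\<Sum>m<n. \<theta>\<^sup>2 * real m / (2 * p))"
  define b where "b = \<theta>\<^sup>2 * n / (2 * p)"
  have "exp (- (a + b)) = exp (- b) * exp (- a)"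
    by (simp flip: exp_add)
  hence "complex_of_real (exp (- (a + b))) = complex_of_real (exp (- b)) * complex_of_real (exp (- a))"
    by (simp only: of_real_mult)
  hence "pair_sum_char (Suc n) \<theta> - complex_of_real (exp (- (a + b))) = 
     (pair_sum_char (Suc n) \<theta> - complex_of_real (exp (- b)) * pair_sum_char n \<theta>) + complex_of_real (exp (- b)) * (pair_sum_char n \<theta> - complex_of_real (exp (- a)))"
    by (simp only: algebra_simps)
  \<comment> \<open>the Gaussian factor has modulus at most 1, so the error inherited from \<open>n\<close> is not amplified\<close>
  also have "norm \<dots> \<le> norm (pair_sum_char (Suc n) \<theta> - complex_of_real (exp (- b)) * pair_sum_char n \<theta>)
      + exp (- b) * norm (pair_sum_char n \<theta> - complex_of_real (exp (- a)))"
    by (rule order.trans[OF norm_triangle_ineq]) (simp add: norm_mult)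
  also have "\<dots> \<le> norm (pair_sum_char (Suc n) \<theta> - complex_of_real (exp (- b)) * pair_sum_char n \<theta>)
      + 1 * norm (pair_sum_char n \<theta> - complex_of_real (exp (- a)))"
    by (intro add_left_mono mult_right_mono) (auto simp: b_def)
  finally show ?case
    using Suc.IH norm_pair_sum_char_step_le[of n \<theta>] by (simp add: a_def b_def)
qed

text \<open>
  With \<open>\<theta> = t \<surd>(2 p) / n\<close> the exponents \<open>\<theta>\<^sup>2 m / (2 p)\<close> sum to
  \<open>\<theta>\<^sup>2 / (2 p) * n (n - 1) / 2 = t\<^sup>2 / 2 * (1 - 1 / n)\<close>. Each summand of the error is bounded
  by its value at \<open>m = n\<close>.
\<close>

lemma norm_scaled_pair_sum_char_minus_gaussian_le:
  assumes "0 < n" "0 < p"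
  shows "norm (pair_sum_char n (t * (sqrt (2 * real p) / real n)) - complex_of_real (exp (- (t\<^sup>2 / 2 * (1 - 1 / real n)))))
    \<le> t ^ 4 / n + 2 * t\<^sup>2 / sqrt p + t ^ 4 / 6 * (p / (real n)\<^sup>2 + 3 / n)"
proof -
  define \<theta> where "\<theta> = t * (sqrt (2 * real p) / real n)"
  have \<theta>2: "\<theta>\<^sup>2 = 2 * p * t\<^sup>2 / (real n)\<^sup>2"
    by (simp add: \<theta>_def power_mult_distrib power_divide)
  have \<theta>4: "\<theta> ^ 4 = 4 * (real p)\<^sup>2 * t ^ 4 / (real n) ^ 4"
  proof -
    have "\<theta> ^ 4 = (\<theta>\<^sup>2)\<^sup>2" by simp
    thus ?thesis unfolding \<theta>2 by (simp add: power_mult_distrib power_divide)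
  qed
  have sum: "(\<Sum>m<n. \<theta>\<^sup>2 * real m / (2 * p)) = t\<^sup>2 / 2 * (1 - 1 / n)"
  proof -
    have "(\<Sum>m<n. real m) = real n * (real n - 1) / 2" by (induction n) (simp_all add: field_simps)
    moreover have "(\<Sum>m<n. \<theta>\<^sup>2 * real m / (2 * p)) = \<theta>\<^sup>2 / (2 * p) * (\<Sum>m<n. real m)"
      by (simp add: sum_distrib_left)
    ultimately have "(\<Sum>m<n. \<theta>\<^sup>2 * real m / (2 * p)) = \<theta>\<^sup>2 / (2 * p) * (real n * (real n - 1) / 2)"
      by (simp only:)
    also have "\<dots> = t\<^sup>2 / 2 * (1 - 1 / n)"
      unfolding \<theta>2 using assms by (simp add: field_simps power2_eq_square)
    finally show ?thesis .
  qed
  have "(\<Sum>m<n. (\<theta>\<^sup>2 * real m / (2 * p))\<^sup>2 + \<theta>\<^sup>2 / p * (real m / sqrt p) + \<theta> ^ 4 / 24 * (real m / p + 3 * (real m / p)\<^sup>2))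
      \<le> (\<Sum>m<n. (\<theta>\<^sup>2 * n / (2 * p))\<^sup>2 + \<theta>\<^sup>2 / p * (n / sqrt p) + \<theta> ^ 4 / 24 * (n / p + 3 * (n / p)\<^sup>2))"
    by (intro sum_mono add_mono mult_left_mono power_mono divide_right_mono) auto
  also have "\<dots> = n * ((\<theta>\<^sup>2 * n / (2 * p))\<^sup>2 + \<theta>\<^sup>2 / p * (n / sqrt p) + \<theta> ^ 4 / 24 * (n / p + 3 * (n / p)\<^sup>2))"
    by simp
  also have "\<dots> = n * (\<theta>\<^sup>2 * n / (2 * p))\<^sup>2 + n * (\<theta>\<^sup>2 / p * (n / sqrt p)) + n * (\<theta> ^ 4 / 24 * (n / p + 3 * (n / p)\<^sup>2))"
    by (simp add: distrib_left)
  also have "n * (\<theta>\<^sup>2 * n / (2 * p))\<^sup>2 = t ^ 4 / n"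
    unfolding \<theta>2 using assms by (simp add: field_simps eval_nat_numeral)
  also have "n * (\<theta>\<^sup>2 / p * (n / sqrt p)) = 2 * t\<^sup>2 / sqrt p"
    unfolding \<theta>2 using assms by (simp add: field_simps eval_nat_numeral)
  also have "n * (\<theta> ^ 4 / 24 * (n / p + 3 * (n / p)\<^sup>2)) = t ^ 4 / 6 * (p / (real n)\<^sup>2 + 3 / n)"
    unfolding \<theta>4 using assms by (simp add: field_simps eval_nat_numeral)
  finally show ?thesis
    using norm_pair_sum_char_minus_gaussian_le[of n \<theta>] unfolding sum \<theta>_def[symmetric] by linarith
qed

end

section \<open>Isotropy of the spherical distribution\<close>

definition sign_flip :: "nat set \<Rightarrow> nat \<Rightarrow> (nat \<Rightarrow> real) \<Rightarrow> (nat \<Rightarrow> real)" where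
  "sign_flip A p x = (\<lambda>k\<in>{..<p}. if k \<in> A then - x k else x k)"

lemma self_normalize_apply: "k < p \<Longrightarrow> self_normalize p x k = x k / sqrt (\<Sum>j<p. (x j)\<^sup>2)"
  by (simp add: self_normalize_def)

lemma self_normalize_sign_flip: "self_normalize p (sign_flip A p x) = sign_flip A p (self_normalize p x)"
proof -
  have "(\<Sum>j<p. (sign_flip A p x j)\<^sup>2) = (\<Sum>j<p. (x j)\<^sup>2)"
    by (intro sum.cong refl) (simp add: sign_flip_def)
  thus ?thesis by (auto simp: self_normalize_def sign_flip_def)
qed

locale symmetric_real_distribution = real_distribution \<mu> for \<mu> +
  assumes symmetric: "symmetric_law \<mu>"
begin

lemma sets_PiM_eq: "sets (Pi\<^sub>M {..<p} (\<lambda>_. \<mu>)) = sets (borel_vec p)"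
  by (intro sets_PiM_cong refl) simp

lemma distr_PiM_sign_flip:
  "distr (Pi\<^sub>M {..<p} (\<lambda>_. \<mu>)) (Pi\<^sub>M {..<p} (\<lambda>_. \<mu>)) (sign_flip A p) = Pi\<^sub>M {..<p} (\<lambda>_. \<mu>)"
proof -
  interpret samples: product_prob_space "\<lambda>_::nat. \<mu>" by standard
  have flip [measurable]: "sign_flip A p \<in> Pi\<^sub>M {..<p} (\<lambda>_. \<mu>) \<rightarrow>\<^sub>M Pi\<^sub>M {..<p} (\<lambda>_. \<mu>)"
    unfolding sign_flip_def by measurable
  show ?thesis
  proof (rule samples.PiM_eqI)
    fix B :: "nat \<Rightarrow> real set" assume B: "\<And>i. i \<in> {..<p} \<Longrightarrow> B i \<in> sets \<mu>"
    \<comment> \<open>the preimage under the flip is the product of these reflected sets\<close>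
    define B' where "B' k = (if k \<in> A then uminus -` B k else B k)" for k
    have uminus_sets: "uminus -` B k \<in> sets \<mu>" if "k < p" for k
      using measurable_sets[of uminus borel borel "B k"] B[of k] that by simp
    have emeasure_eq: "emeasure \<mu> (B' k) = emeasure \<mu> (B k)" if "k < p" for k
    proof -
      have "emeasure \<mu> (B k) = emeasure (distr \<mu> borel uminus) (B k)"
        using symmetric by (simp add: symmetric_law_def)
      also have "\<dots> = emeasure \<mu> (uminus -` B k \<inter> space \<mu>)"
        using B[of k] that by (intro emeasure_distr) auto
      finally show ?thesis by (simp add: B'_def)
    qed
    have "emeasure (distr (Pi\<^sub>M {..<p} (\<lambda>_. \<mu>)) (Pi\<^sub>M {..<p} (\<lambda>_. \<mu>)) (sign_flip A p)) (Pi\<^sub>E {..<p} B) =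
        emeasure (Pi\<^sub>M {..<p} (\<lambda>_. \<mu>)) (sign_flip A p -` Pi\<^sub>E {..<p} B \<inter> space (Pi\<^sub>M {..<p} (\<lambda>_. \<mu>)))"
      using B by (intro emeasure_distr flip sets_PiM_I_finite) auto
    also have "sign_flip A p -` Pi\<^sub>E {..<p} B \<inter> space (Pi\<^sub>M {..<p} (\<lambda>_. \<mu>)) = Pi\<^sub>E {..<p} B'"
    proof (rule set_eqI)
      fix x
      have "x \<in> sign_flip A p -` Pi\<^sub>E {..<p} B \<inter> space (Pi\<^sub>M {..<p} (\<lambda>_. \<mu>)) \<longleftrightarrow>
          (\<forall>k<p. (if k \<in> A then - x k else x k) \<in> B k) \<and> x \<in> extensional {..<p}"
        by (simp add: space_PiM sign_flip_def PiE_iff Ball_def)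
      also have "\<dots> \<longleftrightarrow> x \<in> Pi\<^sub>E {..<p} B'"
        by (auto simp: B'_def PiE_iff)
      finally show "x \<in> sign_flip A p -` Pi\<^sub>E {..<p} B \<inter> space (Pi\<^sub>M {..<p} (\<lambda>_. \<mu>)) \<longleftrightarrow>
          x \<in> Pi\<^sub>E {..<p} B'" .
    qed
    also have "emeasure (Pi\<^sub>M {..<p} (\<lambda>_. \<mu>)) (Pi\<^sub>E {..<p} B') = (\<Prod>k<p. emeasure \<mu> (B' k))"
      using B uminus_sets by (intro samples.emeasure_PiM) (auto simp: B'_def)
    also have "\<dots> = (\<Prod>k<p. emeasure \<mu> (B k))"
      by (intro prod.cong emeasure_eq) auto
    finally show "emeasure (distr (Pi\<^sub>M {..<p} (\<lambda>_. \<mu>)) (Pi\<^sub>M {..<p} (\<lambda>_. \<mu>)) (sign_flip A p)) (Pi\<^sub>E {..<p} B)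
        = (\<Prod>k<p. emeasure \<mu> (B k))" .
  qed auto
qed

lemma sign_flip_measurable [measurable]: "sign_flip A p \<in> borel_vec p \<rightarrow>\<^sub>M borel_vec p"
  unfolding sign_flip_def by measurable

lemma self_normalize_measurable_PiM [measurable]: "self_normalize p \<in> Pi\<^sub>M {..<p} (\<lambda>_. \<mu>) \<rightarrow>\<^sub>M borel_vec p"
  by (rule self_normalize_measurable) simp

lemma spherical_sign_flip_invariant:
  "distr (spherical_distribution \<mu> p) (borel_vec p) (sign_flip A p) = spherical_distribution \<mu> p"
proof -
  let ?P = "Pi\<^sub>M {..<p} (\<lambda>_. \<mu>)"
  have flip: "sign_flip A p \<in> ?P \<rightarrow>\<^sub>M ?P"
    using sign_flip_measurable[of A p] by (simp cong: measurable_cong_sets add: sets_PiM_eq)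
  have "distr (spherical_distribution \<mu> p) (borel_vec p) (sign_flip A p) =
      distr ?P (borel_vec p) (sign_flip A p \<circ> self_normalize p)"
    unfolding spherical_distribution_def by (rule distr_distr) measurable
  also have "sign_flip A p \<circ> self_normalize p = self_normalize p \<circ> sign_flip A p"
    by (auto simp: self_normalize_sign_flip)
  also have "distr ?P (borel_vec p) \<dots> = distr (distr ?P ?P (sign_flip A p)) (borel_vec p) (self_normalize p)"
    by (rule distr_distr[symmetric, OF self_normalize_measurable_PiM flip])
  also have "\<dots> = spherical_distribution \<mu> p"
    by (simp add: distr_PiM_sign_flip spherical_distribution_def)
  finally show ?thesis .
qed

lemma integral_spherical:
  fixes f :: "(nat \<Rightarrow> real) \<Rightarrow> real"
  assumes "f \<in> borel_measurable (borel_vec p)"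
  shows "(\<integral>y. f y \<partial>spherical_distribution \<mu> p) = (\<integral>x. f (self_normalize p x) \<partial>Pi\<^sub>M {..<p} (\<lambda>_. \<mu>))"
  unfolding spherical_distribution_def by (rule integral_distr) (simp_all add: assms)

text \<open>
  Flipping the sign of the coordinate \<open>k\<close> alone preserves the law and negates the product.
\<close>

lemma spherical_mixed_moment:
  assumes "k < p" "l < p" "k \<noteq> l"
  shows "(\<integral>y. y k * y l \<partial>spherical_distribution \<mu> p) = 0"
proof -
  have meas: "(\<lambda>y. y k * y l) \<in> borel_measurable (borel_vec p)"
    using assms by (intro borel_measurable_times coordinate_measurable)
  have flip: "sign_flip {k} p \<in> spherical_distribution \<mu> p \<rightarrow>\<^sub>M borel_vec p"
    by (simp add: spherical_distribution_def)
  have "(\<integral>y. y k * y l \<partial>spherical_distribution \<mu> p) =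
      (\<integral>y. sign_flip {k} p y k * sign_flip {k} p y l \<partial>spherical_distribution \<mu> p)"
    using integral_distr[OF flip meas] by (simp add: spherical_sign_flip_invariant)
  also have "\<dots> = - (\<integral>y. y k * y l \<partial>spherical_distribution \<mu> p)"
    using assms by (simp add: sign_flip_def)
  finally show ?thesis by simp
qed

text \<open>
  The i.i.d. variables are exchangeable, and transposing the coordinates \<open>k\<close> and \<open>l\<close> leaves the
  normalizing denominator unchanged.
\<close>

lemma spherical_square_moment_eq:
  assumes "k < p" "l < p"
  shows "(\<integral>y. (y k)\<^sup>2 \<partial>spherical_distribution \<mu> p) = (\<integral>y. (y l)\<^sup>2 \<partial>spherical_distribution \<mu> p)"
proof -
  let ?P = "Pi\<^sub>M {..<p} (\<lambda>_. \<mu>)" and ?\<tau> = "Transposition.transpose k l"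
  let ?\<pi> = "\<lambda>x. \<lambda>j\<in>{..<p}. x (?\<tau> j)"
  have perm: "?\<tau> permutes {..<p}" using assms by (intro permutes_swap_id) auto
  have meas: "(\<lambda>x. (self_normalize p x j)\<^sup>2) \<in> borel_measurable ?P" if "j < p" for j
    using measurable_compose[OF self_normalize_measurable_PiM coordinate_measurable[OF that]] by measurable
  have \<pi>: "?\<pi> \<in> ?P \<rightarrow>\<^sub>M ?P"
    by (intro measurable_restrict measurable_component_singleton) (use assms in \<open>auto simp: Transposition.transpose_def\<close>)
  have eq: "self_normalize p (?\<pi> x) k = self_normalize p x l" for x
  proof -
    have "(\<Sum>j<p. (?\<pi> x j)\<^sup>2) = (\<Sum>j<p. (x (?\<tau> j))\<^sup>2)" by (intro sum.cong) auto
    also have "\<dots> = (\<Sum>j<p. (x j)\<^sup>2)" by (rule sum.permute[OF perm, symmetric, unfolded comp_def])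
    finally show ?thesis using assms by (simp add: self_normalize_apply)
  qed
  have "(\<integral>x. (self_normalize p x k)\<^sup>2 \<partial>?P) = (\<integral>x. (self_normalize p x k)\<^sup>2 \<partial>distr ?P ?P ?\<pi>)"
    using perm by (subst distr_PiM_reindex) 
      (auto simp: permutes_inj_on Transposition.transpose_def assms prob_space_axioms)
  also have "\<dots> = (\<integral>x. (self_normalize p (?\<pi> x) k)\<^sup>2 \<partial>?P)"
    by (rule integral_distr[OF \<pi> meas[OF assms(1)]])
  also have "\<dots> = (\<integral>x. (self_normalize p x l)\<^sup>2 \<partial>?P)" by (simp only: eq)
  finally show ?thesis using assms by (simp add: integral_spherical)
qed

text \<open>
  The squares of the coordinates sum to 1 and, by exchangeability, have the same mean, which is
  therefore \<open>1/p\<close>.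
\<close>

lemma isotropic_sphere_law_spherical:
  assumes "0 < p" "spherical_well_defined \<mu> p"
  shows "isotropic_sphere_law (spherical_distribution \<mu> p) p"
proof -
  let ?\<nu> = "spherical_distribution \<mu> p"
  interpret \<nu>: prob_space ?\<nu>
    unfolding spherical_distribution_def
    by (intro prob_space.prob_space_distr prob_space_PiM prob_space_axioms self_normalize_measurable_PiM)
  have sets: "sets ?\<nu> = sets (borel_vec p)" by (simp add: spherical_distribution_def)
  have unit: "AE y in ?\<nu>. vec_inner p y y = 1"
    using spherical_distribution_on_sphere[OF _ assms(2)] by (simp add: vec_inner_def power2_eq_square)
  have square: "(\<integral>y. (y k)\<^sup>2 \<partial>?\<nu>) = 1 / p" if k: "k < p" for k
  proof -
    have "integrable ?\<nu> (\<lambda>y. (y j)\<^sup>2)" if "j < p" for j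
    proof (rule \<nu>.integrable_const_bound[of _ 1])
      show "(\<lambda>y. (y j)\<^sup>2) \<in> borel_measurable ?\<nu>"
        using coordinate_measurable[OF that]
        by (subst measurable_cong_sets[OF sets refl]) (rule borel_measurable_power)
      show "AE y in ?\<nu>. norm ((y j)\<^sup>2) \<le> 1"
        using unit
      proof eventually_elim
        case (elim y)
        have "(y j)\<^sup>2 \<le> (\<Sum>i<p. (y i)\<^sup>2)" using that by (intro member_le_sum) auto
        thus ?case using elim by (simp add: vec_inner_def power2_eq_square)
      qed
    qed
    hence "(\<Sum>j<p. \<integral>y. (y j)\<^sup>2 \<partial>?\<nu>) = (\<integral>y. (\<Sum>j<p. (y j)\<^sup>2) \<partial>?\<nu>)"
      by (subst Bochner_Integration.integral_sum) auto
    also have "\<dots> = (\<integral>y. 1 \<partial>?\<nu>)"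
    proof (rule integral_cong_AE)
      show "(\<lambda>y. \<Sum>j<p. (y j)\<^sup>2) \<in> borel_measurable ?\<nu>"
        by (subst measurable_cong_sets[OF sets refl]) measurable
    qed (use unit in \<open>auto simp: vec_inner_def power2_eq_square\<close>)
    finally have "(\<Sum>j<p. \<integral>y. (y j)\<^sup>2 \<partial>?\<nu>) = 1" by (simp add: \<nu>.prob_space)
    moreover have "(\<Sum>j<p. \<integral>y. (y j)\<^sup>2 \<partial>?\<nu>) = (\<Sum>j<p. \<integral>y. (y k)\<^sup>2 \<partial>?\<nu>)"
      using k by (intro sum.cong refl spherical_square_moment_eq) auto
    ultimately show ?thesis using assms(1) by (simp add: field_simps)
  qed
  have "sign_flip UNIV p = vec_uminus p" by (auto simp: sign_flip_def)
  hence "distr ?\<nu> (borel_vec p) (vec_uminus p) = ?\<nu>"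
    using spherical_sign_flip_invariant[of p UNIV] by simp
  moreover have "(\<integral>y. y k * y l \<partial>?\<nu>) = (if k = l then 1 / p else 0)" if "k < p" "l < p" for k l
    using square[OF that(1)] spherical_mixed_moment[OF that] by (cases "k = l") (auto simp: power2_eq_square)
  ultimately show ?thesis
    using sets unit by unfold_locales
qed

end

section \<open>Convergence to the normal distribution\<close>

lemma inner_pair_sum_eq:
  "inner_pair_sum p n x = (\<Sum>(i, j) \<in> {(i, j). 1 \<le> i \<and> i < j \<and> j \<le> n}. vec_inner p (x i) (x j))"
proof -
  have "inner_pair_sum p n x = (\<Sum>(j, i)\<in>(SIGMA j:{1..n}. {1..<j}). vec_inner p (x i) (x j))"
    unfolding inner_pair_sum_def by (rule sum.Sigma) auto
  also have "\<dots> = (\<Sum>(i, j) \<in> {(i, j). 1 \<le> i \<and> i < j \<and> j \<le> n}. vec_inner p (x i) (x j))"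
    by (rule sum.reindex_bij_witness[of _ "\<lambda>(i, j). (j, i)" "\<lambda>(i, j). (j, i)"]) auto
  finally show ?thesis .
qed

text \<open>
  Transfers the computation on the product space to arbitrary independent vectors with the given law.
\<close>

lemma (in isotropic_sphere_law) char_scaled_pair_sum:
  assumes "prob_space N" "0 < n"
    and indep: "prob_space.indep_vars N (\<lambda>_. borel_vec p) Y {1..n}"
    and law: "\<And>i. i \<in> {1..n} \<Longrightarrow> distr N (borel_vec p) (Y i) = \<nu>"
  shows "char (distr N borel (\<lambda>\<omega>. c * inner_pair_sum p n (\<lambda>i. Y i \<omega>))) t = pair_sum_char n (t * c)"
proof -
  interpret N: prob_space N by fact
  have Y: "Y i \<in> N \<rightarrow>\<^sub>M borel_vec p" if "i \<in> {1..n}" for i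
    using indep that by (auto simp: N.indep_vars_def)
  let ?Y = "\<lambda>\<omega>. \<lambda>i\<in>{1..n}. Y i \<omega>"
  have restr: "inner_pair_sum p n (?Y \<omega>) = inner_pair_sum p n (\<lambda>i. Y i \<omega>)" for \<omega>
    unfolding inner_pair_sum_def by (intro sum.cong refl) auto
  have "distr N (Pi\<^sub>M {1..n} (\<lambda>_. borel_vec p)) ?Y = Pi\<^sub>M {1..n} (\<lambda>i. distr N (borel_vec p) (Y i))"
    using N.indep_vars_iff_distr_eq_PiM'[of "{1..n}" Y "\<lambda>_. borel_vec p"] indep Y assms(2) by simp
  also have "\<dots> = sample n"
    unfolding sample_def by (intro PiM_cong refl law)
  finally have distr: "distr N (Pi\<^sub>M {1..n} (\<lambda>_. borel_vec p)) ?Y = sample n" .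
  have Y_measurable: "?Y \<in> N \<rightarrow>\<^sub>M Pi\<^sub>M {1..n} (\<lambda>_. borel_vec p)"
    by (intro measurable_restrict Y)
  have "sets (sample n) = sets (Pi\<^sub>M {1..n} (\<lambda>_. borel_vec p))"
    unfolding sample_def by (intro sets_PiM_cong refl sets_eq)
  hence T: "inner_pair_sum p n \<in> borel_measurable (Pi\<^sub>M {1..n} (\<lambda>_. borel_vec p))"
    using inner_pair_sum_measurable[of n] by (simp cong: measurable_cong_sets)
  have "(\<lambda>\<omega>. inner_pair_sum p n (\<lambda>i. Y i \<omega>)) \<in> borel_measurable N"
    using measurable_compose[OF Y_measurable T] unfolding restr .
  hence meas: "(\<lambda>\<omega>. c * inner_pair_sum p n (\<lambda>i. Y i \<omega>)) \<in> borel_measurable N"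
    by measurable
  have "char (distr N borel (\<lambda>\<omega>. c * inner_pair_sum p n (\<lambda>i. Y i \<omega>))) t =
      (CLINT \<omega>|N. iexp (t * (c * inner_pair_sum p n (\<lambda>i. Y i \<omega>))))"
    unfolding char_def by (rule integral_distr[OF meas]) measurable
  also have "\<dots> = (CLINT \<omega>|N. iexp (t * c * inner_pair_sum p n (?Y \<omega>)))"
    unfolding restr by (simp only: mult.assoc)
  also have "\<dots> = (CLINT x|distr N (Pi\<^sub>M {1..n} (\<lambda>_. borel_vec p)) ?Y. iexp (t * c * inner_pair_sum p n x))"
    by (rule integral_distr[OF Y_measurable, symmetric]) (use T in measurable)
  finally show ?thesis by (simp only: distr pair_sum_char_def)
qed

lemma tendsto_gaussian_error:
  fixes p :: "nat \<Rightarrow> nat"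
  assumes p: "filterlim p at_top sequentially" "(\<lambda>n. real (p n) / (real n)\<^sup>2) \<longlonglongrightarrow> 0"
  shows "(\<lambda>n. t ^ 4 / real n + 2 * t\<^sup>2 / sqrt (real (p n)) + t ^ 4 / 6 * (real (p n) / (real n)\<^sup>2 + 3 / real n)) \<longlonglongrightarrow> 0"
proof -
  have "filterlim (\<lambda>n. sqrt (real (p n))) at_top sequentially"
    by (intro filterlim_compose[OF sqrt_at_top] filterlim_compose[OF filterlim_real_sequentially] p)
  hence "(\<lambda>n. 2 * t\<^sup>2 / sqrt (real (p n))) \<longlonglongrightarrow> 0"
    by (intro tendsto_divide_0[OF tendsto_const] filterlim_at_top_imp_at_infinity)
  moreover have "(\<lambda>n. a / real n) \<longlonglongrightarrow> 0" for a
    by (rule lim_const_over_n)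
  ultimately have "(\<lambda>n. t ^ 4 / real n + 2 * t\<^sup>2 / sqrt (real (p n)) + t ^ 4 / 6 * (real (p n) / (real n)\<^sup>2 + 3 / real n))
      \<longlonglongrightarrow> 0 + 0 + t ^ 4 / 6 * (0 + 0)"
    by (intro tendsto_add tendsto_mult tendsto_const p(2))
  thus ?thesis by simp
qed

theorem theorem1:
  fixes \<alpha> :: real and \<mu> :: "real measure" and p :: "nat \<Rightarrow> nat"
    and M :: "nat \<Rightarrow> 'a measure"
    and X :: "nat \<Rightarrow> nat \<Rightarrow> 'a \<Rightarrow> nat \<Rightarrow> real"
  assumes "0 < \<alpha>" and "\<alpha> < 2"
    and "real_distribution \<mu>"
    and "symmetric_law \<mu>"
    and "regularly_varying_law \<alpha> \<mu>"
    and "\<And>n. 0 < p n"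
    and "filterlim p at_top sequentially"
    and "(\<lambda>n. real (p n) / (real n)\<^sup>2) \<longlonglongrightarrow> 0"
    and "\<And>n. spherical_well_defined \<mu> (p n)"
    and "\<And>n. prob_space (M n)"
    and "\<And>n. prob_space.indep_vars (M n) (\<lambda>_. borel_vec (p n)) (X n) {1..n}"
    and "\<And>n i. i \<in> {1..n} \<Longrightarrow>
           distr (M n) (borel_vec (p n)) (X n i) = spherical_distribution \<mu> (p n)"
  shows "weak_conv_m
           (\<lambda>n. distr (M n) borel (\<lambda>\<omega>.
              sqrt (2 * real (p n)) / real n *
              (\<Sum>(i, j) \<in> {(i, j). 1 \<le> i \<and> i < j \<and> j \<le> n}.
                 vec_inner (p n) (X n i \<omega>) (X n j \<omega>))))
           std_normal_distribution"
proof -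
  interpret \<mu>: symmetric_real_distribution \<mu>
    using assms(3,4) by (simp add: symmetric_real_distribution_def symmetric_real_distribution_axioms_def)
  define R where "R n = (\<lambda>\<omega>. sqrt (2 * real (p n)) / real n * inner_pair_sum (p n) n (\<lambda>i. X n i \<omega>))" for n
  have law: "isotropic_sphere_law (spherical_distribution \<mu> (p n)) (p n)" for n
    by (intro \<mu>.isotropic_sphere_law_spherical assms(6,9))
  have R_measurable: "R n \<in> borel_measurable (M n)" for n
  proof -
    interpret prob_space "M n" by (rule assms(10))
    have "X n i \<in> M n \<rightarrow>\<^sub>M borel_vec (p n)" if "i \<in> {1..n}" for i
      using assms(11)[of n] that by (auto simp: indep_vars_def)
    thus ?thesis
      unfolding R_def inner_pair_sum_def
      by (intro borel_measurable_times borel_measurable_const borel_measurable_sum vec_inner_measurable) auto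
  qed
  have char_R: "(\<lambda>n. char (distr (M n) borel (R n)) t) \<longlonglongrightarrow> char std_normal_distribution t" for t
  proof -
    define g where "g n = complex_of_real (exp (- (t\<^sup>2 / 2 * (1 - 1 / real n))))" for n
    have "\<forall>\<^sub>F n in sequentially. norm (char (distr (M n) borel (R n)) t - g n) \<le>
        t ^ 4 / real n + 2 * t\<^sup>2 / sqrt (real (p n)) + t ^ 4 / 6 * (real (p n) / (real n)\<^sup>2 + 3 / real n)"
      using eventually_gt_at_top[of 0]
    proof eventually_elim
      case (elim n)
      interpret isotropic_sphere_law "spherical_distribution \<mu> (p n)" "p n" by (rule law)
      have char_eq: "char (distr (M n) borel (R n)) t = pair_sum_char n (t * (sqrt (2 * real (p n)) / real n))"
        unfolding R_def by (rule char_scaled_pair_sum[OF assms(10) elim assms(11)]) (rule assms(12))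
      show ?case
        using norm_scaled_pair_sum_char_minus_gaussian_le[OF elim assms(6), of t]
        unfolding char_eq g_def .
    qed
    hence "(\<lambda>n. char (distr (M n) borel (R n)) t - g n) \<longlonglongrightarrow> 0"
      by (rule Lim_null_comparison) (rule tendsto_gaussian_error[OF assms(7,8)])
    moreover have "g \<longlonglongrightarrow> complex_of_real (exp (- (t\<^sup>2 / 2 * (1 - 0))))"
      unfolding g_def by (intro tendsto_intros lim_const_over_n)
    ultimately have "(\<lambda>n. (char (distr (M n) borel (R n)) t - g n) + g n) \<longlonglongrightarrow> 0 + complex_of_real (exp (- (t\<^sup>2 / 2 * (1 - 0))))"
      by (rule tendsto_add)
    thus ?thesis by (simp add: char_std_normal_distribution)
  qed
  have "weak_conv_m (\<lambda>n. distr (M n) borel (R n)) std_normal_distribution"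
  proof (rule levy_continuity[OF _ real_dist_normal_dist char_R])
    show "real_distribution (distr (M n) borel (R n))" for n
      using assms(10) R_measurable
      by (intro prob_space.real_distribution_distr) auto
  qed
  thus ?thesis by (simp only: R_def inner_pair_sum_eq)
qed

end
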